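(* Let $\mathcal{A}$ be a bounded irreducible family of subadditive, order-preserving, homogeneous maps on $\mathbb{R}^n_{\ge0}$. Let $\|\cdot\|$ be a monotone norm on $\mathbb{R}^n$. Then the function $$\|x\|_* := \sup_{f\in\mathcal{A}^*}\|f(|x|)\|$$ is a monotone extremal norm.
   Context: $\mathbb{R}^n_{\ge0}$ is the standard cone of vectors with nonnegative entries in $\mathbb{R}^n$, and $x\ge y$ means $x-y\in\mathbb{R}^n_{\ge0}$. A map on $\mathbb{R}^n_{\ge0}$ means a map $f:\mathbb{R}^n_{\ge0}\to\mathbb{R}^n_{\ge0}$. Such a map is order-preserving if $f(x)\ge f(y)$ whenever $x\ge y$, homogeneous if $f(cx)=cf(x)$ for all $c>0$ and all $x$, and subadditive if $f(x+y)\le f(x)+f(y)$ for all $x,y$. (Order-preserving, homogeneous, subadditive maps on $\mathbb{R}^n_{\ge0}$ are automatically continuous.) For $x\in\mathbb{R}^n$, $|x|$ is the vector obtained by taking the absolute value of each entry. A norm on $\mathbb{R}^n$ is monotone if $\|x\|\le\|y\|$ whenever $0\le x\le y$. For a homogeneous map $f$ on $\mathbb{R}^n_{\ge0}$, $\|f\|:=\sup\{\|f(x)\| : x\in\mathbb{R}^n_{\ge0},\ \|x\|=1\}$; the family $\mathcal{A}$ is bounded if $\{\|f\| : f\in\mathcal{A}\}$ is bounded. For $m\ge1$, $\mathcal{A}^m:=\{f_m\circ\cdots\circ f_1 : f_i\in\mathcal{A}\}$; $\mathcal{A}^0$ consists of the identity map; and $\mathcal{A}^*:=\bigcup_{m\ge0}\mathcal{A}^m$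 is the monoid generated by $\mathcal{A}$. The joint spectral radius is $\hat r(\mathcal{A}):=\inf_{m>0}\sup_{f\in\mathcal{A}^m}\|f\|^{1/m}=\lim_{m\to\infty}\sup_{f\in\mathcal{A}^m}\|f\|^{1/m}$ (independent of the choice of norm on $\mathbb{R}^n$). $\mathcal{A}$ is irreducible if there is no non-trivial closed face of $\mathbb{R}^n_{\ge0}$ (that is, no face other than $\{0\}$ and $\mathbb{R}^n_{\ge0}$ itself) that is an invariant set for all $f\in\mathcal{A}$. An extremal norm for $\mathcal{A}$ is a norm $\|\cdot\|_*$ on $\mathbb{R}^n$ such that $\|f(x)\|_*\le\hat r(\mathcal{A})\|x\|_*$ for all $x\in\mathbb{R}^n_{\ge0}$ and $f\in\mathcal{A}$.
   Formalization: The formula for the norm is proved as stated only when the joint spectral radius equals 1; in general the supremum is over the monoid generated by the family divided by its joint spectral radius (zero maps if the radius is 0), since the literal claim fails, e.g. for the map x to 2x with n=1. *)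

theory Defs
  imports "HOL-Analysis.Analysis"
begin

text \<open>
  A map on the cone is a total function on the whole space that sends the cone to itself; its values
  off the cone are irrelevant to every notion below.  The order and the absolute value on
  \<^typ>\<open>real ^ 'n\<close> are the componentwise ones of HOL-Analysis.
\<close>

definition cone_nonneg :: "(real ^ 'n) set"
  where "cone_nonneg = {x. 0 \<le> x}"

definition maps_cone :: "(real ^ 'n \<Rightarrow> real ^ 'n) \<Rightarrow> bool"
  where "maps_cone f \<longleftrightarrow> (\<forall>x\<in>cone_nonneg. f x \<in> cone_nonneg)"

definition order_preserving :: "(real ^ 'n \<Rightarrow> real ^ 'n) \<Rightarrow> bool"
  where "order_preserving f \<longleftrightarrow>
    (\<forall>x\<in>cone_nonneg. \<forall>y\<in>cone_nonneg. y \<le> x \<longrightarrow> f y \<le> f x)"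

definition homogeneous :: "(real ^ 'n \<Rightarrow> real ^ 'n) \<Rightarrow> bool"
  where "homogeneous f \<longleftrightarrow> (\<forall>c>0. \<forall>x\<in>cone_nonneg. f (c *\<^sub>R x) = c *\<^sub>R f x)"

definition subadditive_map :: "(real ^ 'n \<Rightarrow> real ^ 'n) \<Rightarrow> bool"
  where "subadditive_map f \<longleftrightarrow>
    (\<forall>x\<in>cone_nonneg. \<forall>y\<in>cone_nonneg. f (x + y) \<le> f x + f y)"

definition is_norm :: "(real ^ 'n \<Rightarrow> real) \<Rightarrow> bool"
  where "is_norm N \<longleftrightarrow>
    (\<forall>x. N x = 0 \<longleftrightarrow> x = 0) \<and>
    (\<forall>c x. N (c *\<^sub>R x) = \<bar>c\<bar> * N x) \<and>
    (\<forall>x y. N (x + y) \<le> N x + N y)"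

definition monotone_norm :: "(real ^ 'n \<Rightarrow> real) \<Rightarrow> bool"
  where "monotone_norm N \<longleftrightarrow> is_norm N \<and> (\<forall>x y. 0 \<le> x \<and> x \<le> y \<longrightarrow> N x \<le> N y)"

definition cone_opnorm :: "(real ^ 'n \<Rightarrow> real) \<Rightarrow> (real ^ 'n \<Rightarrow> real ^ 'n) \<Rightarrow> real"
  where "cone_opnorm N f = Sup {N (f x) |x. x \<in> cone_nonneg \<and> N x = 1}"

definition bounded_family :: "(real ^ 'n \<Rightarrow> real) \<Rightarrow> (real ^ 'n \<Rightarrow> real ^ 'n) set \<Rightarrow> bool"
  where "bounded_family N A \<longleftrightarrow> bounded (cone_opnorm N ` A)"

primrec family_power :: "('a \<Rightarrow> 'a) set \<Rightarrow> nat \<Rightarrow> ('a \<Rightarrow> 'a) set"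
  where
    "family_power A 0 = {id}"
  | "family_power A (Suc m) = {f \<circ> g |f g. f \<in> A \<and> g \<in> family_power A m}"

definition generated_monoid :: "('a \<Rightarrow> 'a) set \<Rightarrow> ('a \<Rightarrow> 'a) set"
  where "generated_monoid A = (\<Union>m. family_power A m)"

text \<open>
  The norm \<open>N\<close> is the one used to measure the maps; the value does not depend on it for the
  families under consideration.
\<close>

definition joint_spectral_radius ::
  "(real ^ 'n \<Rightarrow> real) \<Rightarrow> (real ^ 'n \<Rightarrow> real ^ 'n) set \<Rightarrow> real"
  where "joint_spectral_radius N A =
    (INF m\<in>{0<..}. SUP f\<in>family_power A m. root m (cone_opnorm N f))"

text \<open>
  In HOL-Analysis the empty set counts as a face.  It is invariant under every map, so it has to be
  excluded.
\<close>

definition irreducible_family :: "(real ^ 'n \<Rightarrow> real ^ 'n) set \<Rightarrow> bool"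
  where "irreducible_family A \<longleftrightarrow>
    \<not> (\<exists>F. F face_of cone_nonneg \<and> closed F \<and> F \<noteq> {} \<and> F \<noteq> {0} \<and> F \<noteq> cone_nonneg \<and>
         (\<forall>f\<in>A. f ` F \<subseteq> F))"

definition extremal_norm ::
  "(real ^ 'n \<Rightarrow> real) \<Rightarrow> (real ^ 'n \<Rightarrow> real ^ 'n) set \<Rightarrow> (real ^ 'n \<Rightarrow> real) \<Rightarrow> bool"
  where "extremal_norm N A M \<longleftrightarrow>
    is_norm M \<and>
    (\<forall>f\<in>A. \<forall>x\<in>cone_nonneg. M (f x) \<le> joint_spectral_radius N A * M x)"

definition orbit_norm ::
  "(real ^ 'n \<Rightarrow> real) \<Rightarrow> (real ^ 'n \<Rightarrow> real ^ 'n) set \<Rightarrow> real ^ 'n \<Rightarrow> real"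
  where "orbit_norm N A x = (SUP f\<in>generated_monoid A. N (f \<bar>x\<bar>))"

text \<open>
  Finiteness of the supremum defining \<^const>\<open>orbit_norm\<close>; without it the real-valued
  supremum would be a meaningless default value.
\<close>

definition orbit_norm_finite ::
  "(real ^ 'n \<Rightarrow> real) \<Rightarrow> (real ^ 'n \<Rightarrow> real ^ 'n) set \<Rightarrow> bool"
  where "orbit_norm_finite N A \<longleftrightarrow> (\<forall>x. bdd_above ((\<lambda>f. N (f \<bar>x\<bar>)) ` generated_monoid A))"

text \<open>
  The family rescaled to have joint spectral radius 1.  The supremum over the unscaled monoid is
  infinite when the radius exceeds 1 (already for a scalar map), and need not be extremal when the
  radius is below 1.  If the radius is 1 the rescaled family is \<open>A\<close> itself.  If it is 0, then
  \<open>inverse 0 = 0\<close> turns every map into the zero map; for a nonempty bounded irreducible family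
  of subadditive, order-preserving, homogeneous maps this happens only in dimension 1, where every
  map of \<open>A\<close> vanishes on the cone anyway.
\<close>

definition normalized_family ::
  "(real ^ 'n \<Rightarrow> real) \<Rightarrow> (real ^ 'n \<Rightarrow> real ^ 'n) set \<Rightarrow> (real ^ 'n \<Rightarrow> real ^ 'n) set"
  where "normalized_family N A =
    (\<lambda>f x. inverse (joint_spectral_radius N A) *\<^sub>R f x) ` A"

end

theory Submission
  imports Defs
begin

text \<open>
  Write \<open>r\<close> for the joint spectral radius and \<open>e\<^sub>i\<close> for the coordinate vectors.  Every property of the
  orbit norm follows from the subadditivity, homogeneity and monotonicity of the maps as soon as its
  supremum is finite; extremality holds because composing with a map \<open>f\<close> of the rescaled family
  only shrinks the set of products over which the supremum is taken.  So the point is finiteness.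

  The vectors \<open>x\<close> of the cone with a bounded orbit form an order ideal, which is a closed face, and
  this face is invariant.  By irreducibility it is either the whole cone, as desired, or \<open>{0}\<close>.  In
  the second case every \<open>e\<^sub>i\<close> has an unbounded orbit, so some product \<open>g\<close> of rescaled maps has an
  image \<open>g e\<^sub>i\<close> with a coordinate larger than \<open>2\<close>, say \<open>g e\<^sub>i \<ge> 2 e\<^sub>j\<close>.  Following these arrows
  from \<open>i\<close> to \<open>j\<close> among finitely many indices one runs into a cycle: some product \<open>g\<close> of \<open>m > 0\<close>
  rescaled maps satisfies \<open>g e\<^sub>i \<ge> c e\<^sub>i\<close> with \<open>c > 1\<close> (\<open>expansion_cycle\<close>).  Iterating \<open>g\<close> forces
  the joint spectral radius of the rescaled family to be at least the \<open>m\<close>-th root of \<open>c\<close>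
  (\<open>joint_spectral_radius_ge_cycle\<close>), whereas that radius is \<open>1\<close>.

  The same cycle argument settles \<open>r = 0\<close>, when the rescaled maps are all zero and the orbit norm is
  \<open>N \<bar>x\<bar>\<close>.  The common zeros of the maps form an invariant face.  Were it \<open>{0}\<close>, every \<open>e\<^sub>i\<close> would
  have an image dominating a positive multiple of some \<open>e\<^sub>j\<close>, and a cycle would give \<open>r > 0\<close>.  Hence
  all maps vanish on the cone, and extremality is trivial.  An empty family generates only the
  identity; it is treated apart because its joint spectral radius is built from suprema of the empty
  set and hence is an unspecified number.
\<close>

section \<open>The cone and its order ideals\<close>

lemma zero_in_cone [simp]: "0 \<in> cone_nonneg"
  by (simp add: cone_nonneg_def)

lemma axis_in_cone [simp]: "axis i (1::real) \<in> cone_nonneg"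
  by (simp add: cone_nonneg_def less_eq_vec_def axis_def)

lemma abs_in_cone [simp]: "\<bar>x :: real ^ 'n\<bar> \<in> cone_nonneg"
  by (simp add: cone_nonneg_def less_eq_vec_def abs_vec_def)

lemma add_in_cone: "x \<in> cone_nonneg \<Longrightarrow> y \<in> cone_nonneg \<Longrightarrow> x + y \<in> cone_nonneg"
  by (simp add: cone_nonneg_def)

lemma scaleR_in_cone: "0 \<le> c \<Longrightarrow> x \<in> cone_nonneg \<Longrightarrow> c *\<^sub>R x \<in> cone_nonneg"
  by (simp add: cone_nonneg_def less_eq_vec_def)

lemma abs_of_cone: "x \<in> cone_nonneg \<Longrightarrow> \<bar>x :: real ^ 'n\<bar> = x"
  by (simp add: cone_nonneg_def less_eq_vec_def abs_vec_def vec_eq_iff)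

lemma scaleR_axis_le:
  fixes x :: "real ^ 'n"
  assumes "x \<in> cone_nonneg" "c \<le> x $ j"
  shows "c *\<^sub>R axis j 1 \<le> x"
  using assms by (auto simp: cone_nonneg_def less_eq_vec_def axis_def)

lemma convex_cone_nonneg: "convex (cone_nonneg :: (real ^ 'n) set)"
  unfolding convex_def by (auto intro!: add_in_cone scaleR_in_cone)

lemma closed_cone_nonneg: "closed (cone_nonneg :: (real ^ 'n) set)"
proof -
  have "closed {x :: real ^ 'n. \<forall>i. 0 \<le> x $ i}"
    by (intro closed_Collect_all closed_Collect_le continuous_intros)
  then show ?thesis by (simp add: cone_nonneg_def less_eq_vec_def)
qed

text \<open>
  If \<open>x = (1 - u) a + u b\<close> lies in an order ideal then so do \<open>(1 - u) a\<close> and \<open>u b\<close>, being at most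
  \<open>x\<close>; rescaling gives \<open>a\<close> and \<open>b\<close>.
\<close>
lemma order_ideal_face_of_cone:
  fixes F :: "(real ^ 'n) set"
  assumes sub: "F \<subseteq> cone_nonneg"
    and add: "\<And>x y. x \<in> F \<Longrightarrow> y \<in> F \<Longrightarrow> x + y \<in> F"
    and scale: "\<And>c x. 0 \<le> c \<Longrightarrow> x \<in> F \<Longrightarrow> c *\<^sub>R x \<in> F"
    and down: "\<And>x y. x \<in> F \<Longrightarrow> y \<in> cone_nonneg \<Longrightarrow> y \<le> x \<Longrightarrow> y \<in> F"
  shows "F face_of cone_nonneg"
proof -
  have "convex F"
    unfolding convex_def by (auto intro!: add scale)
  moreover have "a \<in> F \<and> b \<in> F"
    if ab: "a \<in> cone_nonneg" "b \<in> cone_nonneg" and x: "x \<in> F" "x \<in> open_segment a b" for a b x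
  proof -
    obtain u where u: "0 < u" "u < 1" and xe: "x = (1 - u) *\<^sub>R a + u *\<^sub>R b"
      using x(2) by (auto simp: in_segment)
    have cone: "(1 - u) *\<^sub>R a \<in> cone_nonneg" "u *\<^sub>R b \<in> cone_nonneg"
      using u ab by (auto intro!: scaleR_in_cone)
    have "(1 - u) *\<^sub>R a \<le> x" "u *\<^sub>R b \<le> x"
      using cone by (simp_all add: xe cone_nonneg_def)
    then have F: "(1 - u) *\<^sub>R a \<in> F" "u *\<^sub>R b \<in> F"
      using down x(1) cone by blast+
    have "inverse (1 - u) *\<^sub>R (1 - u) *\<^sub>R a \<in> F" "inverse u *\<^sub>R u *\<^sub>R b \<in> F"
      using u F by (auto intro!: scale simp del: scaleR_scaleR)
    then show ?thesis using u by simp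
  qed
  ultimately show ?thesis
    using sub unfolding face_of_def by blast
qed

lemma irreducible_family_order_ideal:
  fixes F :: "(real ^ 'n) set"
  assumes irr: "irreducible_family A"
    and ideal: "F \<subseteq> cone_nonneg" "0 \<in> F"
      "\<And>x y. x \<in> F \<Longrightarrow> y \<in> F \<Longrightarrow> x + y \<in> F"
      "\<And>c x. 0 \<le> c \<Longrightarrow> x \<in> F \<Longrightarrow> c *\<^sub>R x \<in> F"
      "\<And>x y. x \<in> F \<Longrightarrow> y \<in> cone_nonneg \<Longrightarrow> y \<le> x \<Longrightarrow> y \<in> F"
    and inv: "\<And>f x. f \<in> A \<Longrightarrow> x \<in> F \<Longrightarrow> f x \<in> F"
  shows "F = {0} \<or> F = cone_nonneg"
proof -
  have face: "F face_of cone_nonneg"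
    using ideal by (intro order_ideal_face_of_cone) auto
  have "closed F"
    using face_of_imp_closed[OF convex_cone_nonneg closed_cone_nonneg face] .
  with face show ?thesis
    using irr ideal(2) inv unfolding irreducible_family_def by blast
qed

lemma cone_le_0_imp_eq_0: "x \<in> cone_nonneg \<Longrightarrow> x \<le> 0 \<Longrightarrow> x = 0"
  by (simp add: cone_nonneg_def)

section \<open>Monotone norms\<close>

lemma monotone_norm_nonneg:
  assumes "monotone_norm N"
  shows "0 \<le> N x"
proof -
  have "N (x + (-1) *\<^sub>R x) \<le> N x + N ((-1) *\<^sub>R x)"
    and "N ((-1) *\<^sub>R x) = \<bar>-1\<bar> * N x" and "N 0 = 0"
    using assms unfolding monotone_norm_def is_norm_def by blast+
  then show ?thesis by simp
qed

lemma monotone_norm_0: "monotone_norm N \<Longrightarrow> N 0 = 0"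
  by (simp add: monotone_norm_def is_norm_def)

lemma monotone_norm_eq_0: "monotone_norm N \<Longrightarrow> N x = 0 \<longleftrightarrow> x = 0"
  by (simp add: monotone_norm_def is_norm_def)

lemma monotone_norm_scaleR: "monotone_norm N \<Longrightarrow> N (c *\<^sub>R x) = \<bar>c\<bar> * N x"
  by (simp add: monotone_norm_def is_norm_def)

lemma monotone_norm_triangle: "monotone_norm N \<Longrightarrow> N (x + y) \<le> N x + N y"
  by (simp add: monotone_norm_def is_norm_def)

lemma monotone_norm_mono: "monotone_norm N \<Longrightarrow> x \<in> cone_nonneg \<Longrightarrow> x \<le> y \<Longrightarrow> N x \<le> N y"
  by (simp add: monotone_norm_def cone_nonneg_def)

lemma monotone_norm_axis_pos: "monotone_norm N \<Longrightarrow> 0 < N (axis i (1::real))"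
  using monotone_norm_nonneg[of N "axis i 1"] monotone_norm_eq_0[of N "axis i 1"]
  by (auto simp: axis_eq_0_iff)

lemma monotone_norm_coordinate_le:
  assumes N: "monotone_norm N" and x: "x \<in> cone_nonneg"
  shows "x $ i * N (axis i 1) \<le> N x"
proof -
  have xi: "0 \<le> x $ i" using x by (simp add: cone_nonneg_def less_eq_vec_def)
  have "N (x $ i *\<^sub>R axis i 1) \<le> N x"
    using x xi by (intro monotone_norm_mono[OF N] scaleR_axis_le scaleR_in_cone) auto
  then show ?thesis using xi by (simp add: monotone_norm_scaleR[OF N])
qed

section \<open>Subadditive, order-preserving, homogeneous maps\<close>

definition monotone_sublinear :: "(real ^ 'n \<Rightarrow> real ^ 'n) \<Rightarrow> bool"
  where "monotone_sublinear f \<longleftrightarrow>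
    maps_cone f \<and> subadditive_map f \<and> order_preserving f \<and> homogeneous f"

lemma monotone_sublinear_cone:
  "monotone_sublinear f \<Longrightarrow> x \<in> cone_nonneg \<Longrightarrow> f x \<in> cone_nonneg"
  by (simp add: monotone_sublinear_def maps_cone_def)

lemma monotone_sublinear_mono:
  "monotone_sublinear f \<Longrightarrow> x \<in> cone_nonneg \<Longrightarrow> y \<in> cone_nonneg \<Longrightarrow> x \<le> y \<Longrightarrow> f x \<le> f y"
  by (simp add: monotone_sublinear_def order_preserving_def)

lemma monotone_sublinear_add:
  "monotone_sublinear f \<Longrightarrow> x \<in> cone_nonneg \<Longrightarrow> y \<in> cone_nonneg \<Longrightarrow> f (x + y) \<le> f x + f y"
  by (simp add: monotone_sublinear_def subadditive_map_def)

text \<open>Homogeneity is only about positive factors, but \<open>f 0 = f (2 \<cdot> 0) = 2 f 0\<close>.\<close>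
lemma monotone_sublinear_0:
  assumes "monotone_sublinear f"
  shows "f 0 = 0"
proof -
  have "f (2 *\<^sub>R 0) = 2 *\<^sub>R f 0"
    using assms unfolding monotone_sublinear_def homogeneous_def
    by (metis zero_in_cone zero_less_numeral)
  then have "(2 - 1) *\<^sub>R f 0 = 0"
    unfolding scaleR_left_diff_distrib by simp
  then show ?thesis by simp
qed

lemma monotone_sublinear_scaleR:
  assumes "monotone_sublinear f" "0 \<le> c" "x \<in> cone_nonneg"
  shows "f (c *\<^sub>R x) = c *\<^sub>R f x"
  using assms monotone_sublinear_0[of f]
  by (cases "c = 0") (auto simp: monotone_sublinear_def homogeneous_def)

lemma monotone_sublinear_id: "monotone_sublinear id"
  by (simp add: monotone_sublinear_def maps_cone_def subadditive_map_def order_preserving_def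
      homogeneous_def)

lemma monotone_sublinear_comp:
  assumes f: "monotone_sublinear f" and g: "monotone_sublinear g"
  shows "monotone_sublinear (f \<circ> g)"
  unfolding monotone_sublinear_def
proof (intro conjI)
  show "maps_cone (f \<circ> g)"
    using monotone_sublinear_cone[OF f] monotone_sublinear_cone[OF g] by (simp add: maps_cone_def)
  show "subadditive_map (f \<circ> g)"
    unfolding subadditive_map_def
  proof (intro ballI)
    fix x y :: "real ^ 'a" assume xy: "x \<in> cone_nonneg" "y \<in> cone_nonneg"
    note c = monotone_sublinear_cone[OF g xy(1)] monotone_sublinear_cone[OF g xy(2)]
      monotone_sublinear_cone[OF g add_in_cone[OF xy]]
    have "f (g (x + y)) \<le> f (g x + g y)"
      by (intro monotone_sublinear_mono[OF f] c add_in_cone monotone_sublinear_add[OF g] xy)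
    also have "\<dots> \<le> f (g x) + f (g y)"
      by (intro monotone_sublinear_add[OF f] c)
    finally show "(f \<circ> g) (x + y) \<le> (f \<circ> g) x + (f \<circ> g) y" by simp
  qed
  show "order_preserving (f \<circ> g)"
    unfolding order_preserving_def
    by (auto intro!: monotone_sublinear_mono[OF f] monotone_sublinear_mono[OF g]
        monotone_sublinear_cone[OF g])
  show "homogeneous (f \<circ> g)"
    unfolding homogeneous_def
    by (auto simp: monotone_sublinear_scaleR[OF f] monotone_sublinear_scaleR[OF g]
        monotone_sublinear_cone[OF g])
qed

lemma monotone_sublinear_scale:
  assumes f: "monotone_sublinear f" and s: "0 \<le> s"
  shows "monotone_sublinear (\<lambda>x. s *\<^sub>R f x)"
  unfolding monotone_sublinear_def maps_cone_def subadditive_map_def order_preserving_def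
    homogeneous_def
  using s
  by (auto intro!: scaleR_in_cone scaleR_left_mono monotone_sublinear_cone[OF f]
      monotone_sublinear_mono[OF f] monotone_sublinear_add[OF f]
      simp: monotone_sublinear_scaleR[OF f] scaleR_add_right[symmetric] simp del: scaleR_add_right)

text \<open>
  The unit sphere of the cone lies below one multiple \<open>C\<close> of the all-ones vector, so \<open>N (f (C 1))\<close>
  bounds the set whose supremum is the operator norm.
\<close>
lemma cone_opnorm_bound:
  assumes N: "monotone_norm N" and f: "monotone_sublinear f" and x: "x \<in> cone_nonneg"
  shows "N (f x) \<le> cone_opnorm N f * N x"
proof (cases "x = 0")
  case True
  then show ?thesis by (simp add: monotone_sublinear_0[OF f] monotone_norm_0[OF N])
next
  case False
  define u :: "real ^ 'a" where "u = (\<Sum>i\<in>UNIV. 1 / N (axis i 1)) *\<^sub>R 1"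
  have bnd: "y \<le> u" if y: "y \<in> cone_nonneg" "N y = 1" for y
    unfolding less_eq_vec_def
  proof
    fix i
    have "y $ i \<le> 1 / N (axis i 1)"
      using monotone_norm_coordinate_le[OF N y(1), of i] monotone_norm_axis_pos[OF N, of i] y(2)
      by (simp add: field_simps)
    also have "\<dots> \<le> (\<Sum>i\<in>UNIV. 1 / N (axis i 1))"
      by (rule member_le_sum) (auto intro: monotone_norm_nonneg[OF N])
    finally show "y $ i \<le> u $ i" by (simp add: u_def)
  qed
  have bdd: "bdd_above {N (f y) |y. y \<in> cone_nonneg \<and> N y = 1}"
  proof (rule bdd_aboveI)
    fix t assume "t \<in> {N (f y) |y. y \<in> cone_nonneg \<and> N y = 1}"
    then obtain y where y: "t = N (f y)" "y \<in> cone_nonneg" "N y = 1" by blast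
    have yu: "y \<le> u" by (rule bnd[OF y(2,3)])
    then have "u \<in> cone_nonneg" using y(2) by (auto simp: cone_nonneg_def)
    then show "t \<le> N (f u)"
      unfolding y(1) using yu y(2)
      by (intro monotone_norm_mono[OF N] monotone_sublinear_mono[OF f] monotone_sublinear_cone[OF f])
  qed
  have Nx: "0 < N x"
    using False monotone_norm_nonneg[OF N, of x] monotone_norm_eq_0[OF N, of x] by simp
  define y where "y = inverse (N x) *\<^sub>R x"
  have yc: "y \<in> cone_nonneg" using Nx x by (simp add: y_def scaleR_in_cone)
  moreover have "N y = 1" using Nx by (simp add: y_def monotone_norm_scaleR[OF N])
  ultimately have "N (f y) \<le> cone_opnorm N f"
    unfolding cone_opnorm_def by (intro cSup_upper bdd) blast
  moreover have "N (f x) = N x * N (f y)"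
  proof -
    have "x = N x *\<^sub>R y" using Nx by (simp add: y_def)
    then have "f x = N x *\<^sub>R f y"
      using monotone_sublinear_scaleR[OF f _ yc, of "N x"] Nx by simp
    then show ?thesis using Nx by (simp add: monotone_norm_scaleR[OF N])
  qed
  ultimately show ?thesis using Nx by (simp add: mult.commute)
qed

lemma cone_opnorm_nonneg:
  assumes N: "monotone_norm N" and f: "monotone_sublinear f"
  shows "0 \<le> cone_opnorm N f"
proof -
  fix i :: 'a
  have "0 \<le> cone_opnorm N f * N (axis i 1)"
    using cone_opnorm_bound[OF N f axis_in_cone] monotone_norm_nonneg[OF N] order_trans by blast
  then show ?thesis using monotone_norm_axis_pos[OF N, of i] by (simp add: zero_le_mult_iff)
qed

lemma cone_opnorm_le:
  fixes f :: "real ^ 'n \<Rightarrow> real ^ 'n"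
  assumes N: "monotone_norm N" and K: "\<And>x. x \<in> cone_nonneg \<Longrightarrow> N (f x) \<le> K * N x"
  shows "cone_opnorm N f \<le> K"
  unfolding cone_opnorm_def
proof (rule cSup_least)
  fix i :: 'n
  let ?y = "inverse (N (axis i 1)) *\<^sub>R axis i 1 :: real ^ 'n"
  have "?y \<in> cone_nonneg" "N ?y = 1"
    using monotone_norm_axis_pos[OF N, of i]
    by (auto intro!: scaleR_in_cone simp: monotone_norm_scaleR[OF N])
  then show "{N (f x) |x. x \<in> cone_nonneg \<and> N x = 1} \<noteq> {}" by blast
qed (use K in fastforce)

section \<open>Products of maps of a family\<close>

lemma family_power_monotone_sublinear:
  assumes "\<And>f. f \<in> A \<Longrightarrow> monotone_sublinear f" "g \<in> family_power A m"
  shows "monotone_sublinear g"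
  using assms(2)
  by (induction m arbitrary: g) (auto intro: monotone_sublinear_id monotone_sublinear_comp assms(1))

lemma family_power_add:
  "h \<in> family_power A (m + k) \<longleftrightarrow> (\<exists>f\<in>family_power A m. \<exists>g\<in>family_power A k. h = f \<circ> g)"
proof (induction m arbitrary: h)
  case (Suc m)
  have "h \<in> family_power A (Suc m + k) \<longleftrightarrow>
      (\<exists>e\<in>A. \<exists>f\<in>family_power A m. \<exists>g\<in>family_power A k. h = e \<circ> (f \<circ> g))"
    unfolding add_Suc family_power.simps(2) mem_Collect_eq Suc.IH by blast
  also have "\<dots> \<longleftrightarrow> (\<exists>f\<in>family_power A (Suc m). \<exists>g\<in>family_power A k. h = f \<circ> g)"
    unfolding family_power.simps(2) mem_Collect_eq comp_assoc[symmetric] by blast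
  finally show ?case .
qed simp

lemma family_power_1: "f \<in> A \<Longrightarrow> f \<in> family_power A 1"
  by (force simp: comp_def id_def)

lemma funpow_in_family_power: "g \<in> family_power A m \<Longrightarrow> (g ^^ p) \<in> family_power A (p * m)"
  by (induction p) (auto simp: family_power_add)

lemma family_power_nonempty: "A \<noteq> {} \<Longrightarrow> family_power A m \<noteq> {}"
  by (induction m) auto

lemma generated_monoid_empty: "generated_monoid {} = {id}"
proof -
  have "family_power {} m \<subseteq> {id}" for m :: nat by (cases m) auto
  moreover have "id \<in> family_power {} 0" by simp
  ultimately show ?thesis unfolding generated_monoid_def by blast
qed

lemma id_in_generated_monoid: "id \<in> generated_monoid A"
  unfolding generated_monoid_def using family_power.simps(1) by blast

lemma comp_in_generated_monoid:
  assumes "h \<in> generated_monoid A" "f \<in> A"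
  shows "h \<circ> f \<in> generated_monoid A"
proof -
  obtain m where "h \<in> family_power A m" using assms(1) by (auto simp: generated_monoid_def)
  then have "h \<circ> f \<in> family_power A (m + 1)"
    using family_power_1[OF assms(2)] unfolding family_power_add by blast
  then show ?thesis unfolding generated_monoid_def by blast
qed

lemma generated_monoid_monotone_sublinear:
  assumes "\<And>f. f \<in> A \<Longrightarrow> monotone_sublinear f" "g \<in> generated_monoid A"
  shows "monotone_sublinear g"
  using assms family_power_monotone_sublinear unfolding generated_monoid_def by blast

lemma family_power_norm_le:
  fixes N :: "real ^ 'n \<Rightarrow> real"
  assumes f: "\<forall>f\<in>A. \<forall>x\<in>cone_nonneg. f x \<in> cone_nonneg \<and> N (f x) \<le> K * N x"
    and K: "0 \<le> K" and g: "g \<in> family_power A m" and x: "x \<in> cone_nonneg"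
  shows "g x \<in> cone_nonneg \<and> N (g x) \<le> K ^ m * N x"
  using g
proof (induction m arbitrary: g)
  case 0
  then show ?case using x by simp
next
  case (Suc m)
  then obtain e h where g: "g = e \<circ> h" "e \<in> A" "h \<in> family_power A m" by auto
  note IH = Suc.IH[OF g(3)]
  have "N (e (h x)) \<le> K * N (h x)" using f g(2) IH by blast
  also have "\<dots> \<le> K * (K ^ m * N x)" using IH K by (intro mult_left_mono) auto
  finally show ?case using f g(1,2) IH by (auto simp: mult.assoc)
qed

lemma family_power_mult:
  "family_power A (m * p) \<subseteq> family_power (family_power A m) p"
proof (induction p)
  case (Suc p)
  show ?case
  proof
    fix h assume "h \<in> family_power A (m * Suc p)"
    then obtain f g where "f \<in> family_power A m" "g \<in> family_power A (m * p)" "h = f \<circ> g"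
      by (auto simp: family_power_add)
    then show "h \<in> family_power (family_power A m) (Suc p)" using Suc.IH by auto
  qed
qed simp

text \<open>
  Rescaling every factor by \<open>s\<close> rescales a product of length \<open>m\<close> by \<open>s ^ m\<close>; this holds on the cone
  only, where the maps are homogeneous.
\<close>
lemma family_power_scaled:
  assumes sl: "\<And>f. f \<in> A \<Longrightarrow> monotone_sublinear f" and s: "0 \<le> s"
    and h: "h \<in> family_power ((\<lambda>f x. s *\<^sub>R f x) ` A) m"
  shows "\<exists>g\<in>family_power A m. \<forall>x\<in>cone_nonneg. h x = s ^ m *\<^sub>R g x"
  using h
proof (induction m arbitrary: h)
  case (Suc m)
  then obtain f k where h: "h = (\<lambda>x. s *\<^sub>R f x) \<circ> k" "f \<in> A"
      "k \<in> family_power ((\<lambda>f x. s *\<^sub>R f x) ` A) m" by auto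
  obtain g where g: "g \<in> family_power A m" "\<forall>x\<in>cone_nonneg. k x = s ^ m *\<^sub>R g x"
    using Suc.IH[OF h(3)] by blast
  have gs: "monotone_sublinear g" using family_power_monotone_sublinear sl g(1) by blast
  have "h x = s ^ Suc m *\<^sub>R (f \<circ> g) x" if "x \<in> cone_nonneg" for x
    using that g(2) s monotone_sublinear_scaleR[OF sl[OF h(2)]] monotone_sublinear_cone[OF gs]
    by (simp add: h(1))
  then show ?case using g(1) h(2) by force
qed simp

section \<open>Cycles and the joint spectral radius\<close>

lemma cone_opnorm_family_power_bdd:
  fixes A :: "(real ^ 'n \<Rightarrow> real ^ 'n) set"
  assumes N: "monotone_norm N" and sl: "\<And>f. f \<in> A \<Longrightarrow> monotone_sublinear f"
    and bnd: "bounded_family N A"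
  shows "bdd_above ((\<lambda>f. root m (cone_opnorm N f)) ` family_power A m)"
proof -
  obtain K where K: "\<And>f. f \<in> A \<Longrightarrow> \<bar>cone_opnorm N f\<bar> \<le> K"
    using bnd by (auto simp: bounded_family_def bounded_iff)
  define L where "L = max K 0"
  have step: "\<forall>f\<in>A. \<forall>x\<in>cone_nonneg. f x \<in> cone_nonneg \<and> N (f x) \<le> L * N x"
  proof (intro ballI)
    fix f and x :: "real ^ 'n" assume that: "f \<in> A" "x \<in> cone_nonneg"
    have "N (f x) \<le> cone_opnorm N f * N x" by (rule cone_opnorm_bound[OF N sl[OF that(1)] that(2)])
    also have "\<dots> \<le> L * N x"
      using K[OF that(1)] monotone_norm_nonneg[OF N, of x] by (intro mult_right_mono) (auto simp: L_def)
    finally show "f x \<in> cone_nonneg \<and> N (f x) \<le> L * N x"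
      using monotone_sublinear_cone[OF sl[OF that(1)] that(2)] by simp
  qed
  have "cone_opnorm N g \<le> L ^ m" if "g \<in> family_power A m" for g
    using family_power_norm_le[OF step _ that] by (intro cone_opnorm_le[OF N]) (auto simp: L_def)
  then have "root m (cone_opnorm N g) \<le> root m (L ^ m)" if "g \<in> family_power A m" for g
    using that by (cases "m = 0") auto
  then show ?thesis by (intro bdd_aboveI2)
qed

text \<open>
  The powers \<open>g ^ p\<close> still expand \<open>axis i 1\<close> by \<open>c ^ p\<close>, and by submultiplicativity the supremum
  \<open>S\<close> at any length \<open>p\<close> controls \<open>g ^ p\<close>, which is a product of \<open>m\<close> blocks of length \<open>p\<close>.  This
  bounds every term of the infimum from below, not only those whose length is a multiple of \<open>m\<close>.
\<close>
lemma joint_spectral_radius_ge_cycle: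
  fixes A :: "(real ^ 'n \<Rightarrow> real ^ 'n) set"
  assumes N: "monotone_norm N" and sl: "\<And>f. f \<in> A \<Longrightarrow> monotone_sublinear f"
    and bnd: "bounded_family N A"
    and g: "g \<in> family_power A m" and m: "0 < m"
    and c: "0 \<le> c" and cyc: "c *\<^sub>R axis i 1 \<le> g (axis i 1)"
  shows "root m c \<le> joint_spectral_radius N A"
  unfolding joint_spectral_radius_def
proof (rule cINF_greatest)
  fix p :: nat assume "p \<in> {0<..}"
  then have p: "0 < p" by simp
  define S where "S = (SUP f\<in>family_power A p. root p (cone_opnorm N f))"
  have Aslp: "monotone_sublinear f" if "f \<in> family_power A q" for f q
    using family_power_monotone_sublinear sl that by blast
  have up: "root p (cone_opnorm N f) \<le> S" if "f \<in> family_power A p" for f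
    unfolding S_def by (intro cSUP_upper that cone_opnorm_family_power_bdd[OF N sl bnd])
  have "A \<noteq> {}" using g m by (cases m) auto
  then obtain f0 where "f0 \<in> family_power A p" using family_power_nonempty by blast
  then have S0: "0 \<le> S"
    using up[of f0] cone_opnorm_nonneg[OF N Aslp, of f0 p] p
    by (meson order_trans real_root_ge_zero)
  have le: "\<forall>f\<in>family_power A p. \<forall>x\<in>cone_nonneg. f x \<in> cone_nonneg \<and> N (f x) \<le> S ^ p * N x"
  proof (intro ballI)
    fix f and x :: "real ^ 'n" assume f: "f \<in> family_power A p" and x: "x \<in> cone_nonneg"
    have "cone_opnorm N f = root p (cone_opnorm N f) ^ p"
      using cone_opnorm_nonneg[OF N Aslp[OF f]] p by simp
    also have "\<dots> \<le> S ^ p"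
      using up[OF f] cone_opnorm_nonneg[OF N Aslp[OF f]] p by (intro power_mono) auto
    finally have "cone_opnorm N f * N x \<le> S ^ p * N x"
      using monotone_norm_nonneg[OF N] by (intro mult_right_mono)
    then show "f x \<in> cone_nonneg \<and> N (f x) \<le> S ^ p * N x"
      using cone_opnorm_bound[OF N Aslp[OF f] x] monotone_sublinear_cone[OF Aslp[OF f] x] by auto
  qed
  have "g ^^ p \<in> family_power (family_power A p) m"
    using funpow_in_family_power[OF g, of p] family_power_mult by blast
  from family_power_norm_le[OF le _ this axis_in_cone] S0
  have upper: "N ((g ^^ p) (axis i 1)) \<le> (S ^ p) ^ m * N (axis i 1)" by auto
  have "(g ^^ q) (axis i 1) \<in> cone_nonneg \<and> c ^ q *\<^sub>R axis i 1 \<le> (g ^^ q) (axis i 1)" for q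
  proof (induction q)
    case (Suc q)
    let ?y = "(g ^^ q) (axis i 1)"
    have "c ^ Suc q *\<^sub>R axis i 1 = c ^ q *\<^sub>R c *\<^sub>R axis i 1" by simp
    also have "\<dots> \<le> c ^ q *\<^sub>R g (axis i 1)" using c cyc by (intro scaleR_left_mono) auto
    also have "\<dots> = g (c ^ q *\<^sub>R axis i 1)"
      using c by (intro monotone_sublinear_scaleR[OF Aslp[OF g], symmetric]) auto
    also have "\<dots> \<le> g ?y"
      using Suc c by (intro monotone_sublinear_mono[OF Aslp[OF g]] scaleR_in_cone) auto
    finally show ?case using Suc monotone_sublinear_cone[OF Aslp[OF g]] by simp
  qed simp
  then have "N (c ^ p *\<^sub>R axis i 1) \<le> N ((g ^^ p) (axis i 1))"
    using c by (intro monotone_norm_mono[OF N] scaleR_in_cone) auto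
  with upper have "c ^ p * N (axis i 1) \<le> (S ^ p) ^ m * N (axis i 1)"
    using c by (simp add: monotone_norm_scaleR[OF N])
  then have "c ^ p \<le> (S ^ m) ^ p"
    using monotone_norm_axis_pos[OF N, of i] by (simp add: power_mult[symmetric] mult.commute)
  \<comment> \<open>The shift by one fits \<open>power_le_imp_le_base\<close>, which is about exponents \<open>Suc n\<close>.\<close>
  then have "c \<le> S ^ m"
    using p S0 power_le_imp_le_base[of c "p - 1" "S ^ m"] by simp
  then show "root m c \<le> S"
    using m S0 by (metis real_root_le_iff real_root_power_cancel)
qed simp

text \<open>
  Chaining \<open>g e\<^sub>i \<ge> c e\<^sub>j\<close> and \<open>h e\<^sub>j \<ge> d e\<^sub>k\<close> gives \<open>h (g e\<^sub>i) \<ge> c d e\<^sub>k\<close>, so these arrows form a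
  transitive relation on a finite set.  A transitive relation with an arrow out of every point has a
  loop, for otherwise some point would be maximal.  The predicate \<open>P\<close> is used with \<open>c > 1\<close> and with
  \<open>c > 0\<close>.
\<close>
lemma expansion_cycle:
  fixes A :: "(real ^ 'n \<Rightarrow> real ^ 'n) set"
  assumes sl: "\<And>f. f \<in> A \<Longrightarrow> monotone_sublinear f"
    and P_pos: "\<And>c. P c \<Longrightarrow> 0 < c" and P_mult: "\<And>c d. P c \<Longrightarrow> P d \<Longrightarrow> P (c * d)"
    and out: "\<And>i. \<exists>j m g c. 0 < m \<and> g \<in> family_power A m \<and> P c \<and>
      c *\<^sub>R axis j 1 \<le> g (axis i 1)"
  obtains i m g c where "0 < m" "g \<in> family_power A m" "P c" "c *\<^sub>R axis i 1 \<le> g (axis i 1)"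
proof -
  define R where "R i j \<longleftrightarrow> (\<exists>m g c. 0 < m \<and> g \<in> family_power A m \<and> P c \<and>
      c *\<^sub>R axis j 1 \<le> g (axis i 1))" for i j :: 'n
  have trans: "R i k" if ij: "R i j" and jk: "R j k" for i j k
  proof -
    obtain m g c where g: "0 < m" "g \<in> family_power A m" "P c" "c *\<^sub>R axis j 1 \<le> g (axis i 1)"
      using ij unfolding R_def by blast
    obtain l h d where h: "0 < l" "h \<in> family_power A l" "P d" "d *\<^sub>R axis k 1 \<le> h (axis j 1)"
      using jk unfolding R_def by blast
    have gs: "monotone_sublinear g" and hs: "monotone_sublinear h"
      using family_power_monotone_sublinear sl g(2) h(2) by blast+
    have "(c * d) *\<^sub>R axis k 1 = c *\<^sub>R d *\<^sub>R axis k 1" by simp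
    also have "\<dots> \<le> c *\<^sub>R h (axis j 1)"
      using h(4) P_pos[OF g(3)] by (intro scaleR_left_mono) auto
    also have "\<dots> = h (c *\<^sub>R axis j 1)"
      using P_pos[OF g(3)] by (intro monotone_sublinear_scaleR[OF hs, symmetric]) auto
    also have "\<dots> \<le> h (g (axis i 1))"
      using P_pos[OF g(3)] g(4)
      by (intro monotone_sublinear_mono[OF hs] scaleR_in_cone monotone_sublinear_cone[OF gs]) auto
    finally have "(c * d) *\<^sub>R axis k 1 \<le> (h \<circ> g) (axis i 1)" by simp
    moreover have "h \<circ> g \<in> family_power A (l + m)" using g(2) h(2) by (auto simp: family_power_add)
    ultimately show ?thesis
      unfolding R_def using P_mult[OF g(3) h(3)] g(1)
      by (intro exI[of _ "l + m"] exI[of _ "h \<circ> g"] exI[of _ "c * d"]) simp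
  qed
  have "\<exists>i. R i i"
  proof (rule ccontr)
    assume no: "\<not> (\<exists>i. R i i)"
    have "asymp_on UNIV R"
      using no trans by (intro asymp_onI) blast
    moreover have "transp_on UNIV R"
      using trans by (intro transp_onI) blast
    ultimately have "\<exists>m\<in>UNIV. \<forall>x\<in>UNIV. x \<noteq> m \<longrightarrow> \<not> R m x"
      by (intro Finite_Set.bex_max_element) auto
    then obtain i where "\<forall>x. x \<noteq> i \<longrightarrow> \<not> R i x" by blast
    then have "\<not> R i x" for x using no by metis
    then show False using out[of i] unfolding R_def by blast
  qed
  then show ?thesis using that unfolding R_def by blast
qed

section \<open>Boundedness of the orbits\<close>

lemma large_norm_coordinate:
  fixes x :: "real ^ 'n"
  assumes N: "monotone_norm N" and x: "x \<in> cone_nonneg" and large: "2 * N 1 < N x"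
  shows "\<exists>j. 2 < x $ j"
proof (rule ccontr)
  assume "\<not> ?thesis"
  then have "x \<le> 2 *\<^sub>R 1" by (auto simp: less_eq_vec_def not_less)
  then have "N x \<le> N (2 *\<^sub>R 1)" by (rule monotone_norm_mono[OF N x])
  then show False using large by (simp add: monotone_norm_scaleR[OF N])
qed

text \<open>
  The vectors with a bounded orbit form an invariant order ideal \<open>F\<close>.  If \<open>F = {0}\<close>, unbounded orbits
  of the coordinate vectors produce a cycle with a factor \<open>c > 1\<close> for the rescaled family.  In terms
  of \<open>A\<close> the cycle has length \<open>m\<close> and factor \<open>c r ^ m\<close>, too large for the radius \<open>r\<close>.
\<close>
lemma normalized_orbit_bounded:
  fixes A :: "(real ^ 'n \<Rightarrow> real ^ 'n) set"
  assumes N: "monotone_norm N" and sl: "\<And>f. f \<in> A \<Longrightarrow> monotone_sublinear f"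
    and bnd: "bounded_family N A" and irr: "irreducible_family A"
    and r: "0 < joint_spectral_radius N A" and x: "x \<in> cone_nonneg"
  shows "bdd_above ((\<lambda>f. N (f x)) ` generated_monoid (normalized_family N A))"
proof -
  define s where "s = inverse (joint_spectral_radius N A)"
  define B where "B = normalized_family N A"
  have s: "0 < s" using r by (simp add: s_def)
  have Bdef: "B = (\<lambda>f x. s *\<^sub>R f x) ` A" by (simp add: B_def s_def normalized_family_def)
  have Bsl: "monotone_sublinear f" if "f \<in> B" for f
    using that sl s unfolding Bdef by (auto intro: monotone_sublinear_scale)
  have Msl: "monotone_sublinear h" if "h \<in> generated_monoid B" for h
    using generated_monoid_monotone_sublinear Bsl that by blast
  define F where "F = {x \<in> cone_nonneg. \<exists>K. \<forall>h\<in>generated_monoid B. N (h x) \<le> K}"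
  have "F = {0} \<or> F = cone_nonneg"
  proof (rule irreducible_family_order_ideal[OF irr])
    show "F \<subseteq> cone_nonneg" by (auto simp: F_def)
    show "0 \<in> F" by (auto simp: F_def monotone_sublinear_0[OF Msl] monotone_norm_0[OF N])
    fix x y :: "real ^ 'n" assume "x \<in> F" "y \<in> F"
    then obtain K L where x: "x \<in> cone_nonneg" "\<And>h. h \<in> generated_monoid B \<Longrightarrow> N (h x) \<le> K"
        and y: "y \<in> cone_nonneg" "\<And>h. h \<in> generated_monoid B \<Longrightarrow> N (h y) \<le> L"
      by (auto simp: F_def)
    have "N (h (x + y)) \<le> K + L" if h: "h \<in> generated_monoid B" for h
    proof -
      have "N (h (x + y)) \<le> N (h x + h y)"
        using x(1) y(1)
        by (intro monotone_norm_mono[OF N] monotone_sublinear_add[OF Msl[OF h]]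
            monotone_sublinear_cone[OF Msl[OF h]] add_in_cone)
      also have "\<dots> \<le> N (h x) + N (h y)" by (rule monotone_norm_triangle[OF N])
      also have "\<dots> \<le> K + L" using x(2)[OF h] y(2)[OF h] by simp
      finally show ?thesis .
    qed
    then show "x + y \<in> F" using x(1) y(1) by (auto simp: F_def add_in_cone)
  next
    fix c :: real and x :: "real ^ 'n" assume c: "0 \<le> c" and "x \<in> F"
    then obtain K where x: "x \<in> cone_nonneg" "\<And>h. h \<in> generated_monoid B \<Longrightarrow> N (h x) \<le> K"
      by (auto simp: F_def)
    have "N (h (c *\<^sub>R x)) \<le> c * K" if h: "h \<in> generated_monoid B" for h
      using c x(2)[OF h]
      by (simp add: monotone_sublinear_scaleR[OF Msl[OF h] c x(1)] monotone_norm_scaleR[OF N]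
          mult_left_mono)
    then show "c *\<^sub>R x \<in> F" using x(1) c by (auto simp: F_def scaleR_in_cone)
  next
    fix x y :: "real ^ 'n" assume "x \<in> F" and y: "y \<in> cone_nonneg" "y \<le> x"
    then obtain K where x: "x \<in> cone_nonneg" "\<And>h. h \<in> generated_monoid B \<Longrightarrow> N (h x) \<le> K"
      by (auto simp: F_def)
    have "N (h y) \<le> K" if h: "h \<in> generated_monoid B" for h
    proof -
      have "N (h y) \<le> N (h x)"
        using x(1) y by (intro monotone_norm_mono[OF N] monotone_sublinear_mono[OF Msl[OF h]]
            monotone_sublinear_cone[OF Msl[OF h]])
      then show ?thesis using x(2)[OF h] by simp
    qed
    then show "y \<in> F" using y(1) by (auto simp: F_def)
  next
    fix f and x :: "real ^ 'n" assume f: "f \<in> A" and "x \<in> F"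
    then obtain K where x: "x \<in> cone_nonneg" "\<And>h. h \<in> generated_monoid B \<Longrightarrow> N (h x) \<le> K"
      by (auto simp: F_def)
    have fx: "f x \<in> cone_nonneg" by (rule monotone_sublinear_cone[OF sl[OF f] x(1)])
    have "N (h (f x)) \<le> K / s" if h: "h \<in> generated_monoid B" for h
    proof -
      have "h \<circ> (\<lambda>x. s *\<^sub>R f x) \<in> generated_monoid B"
        using h f by (intro comp_in_generated_monoid) (auto simp: Bdef)
      from x(2)[OF this] have "N (h (s *\<^sub>R f x)) \<le> K" by simp
      then show ?thesis
        using s fx by (simp add: monotone_sublinear_scaleR[OF Msl[OF h]] monotone_norm_scaleR[OF N]
            field_simps)
    qed
    then show "f x \<in> F" using fx by (auto simp: F_def)
  qed
  moreover have "F \<noteq> {0}"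
  proof
    assume F0: "F = {0}"
    have out: "\<exists>j m g c. 0 < m \<and> g \<in> family_power B m \<and> 1 < c \<and> c *\<^sub>R axis j 1 \<le> g (axis i 1)" for i
    proof -
      have "axis i 1 \<notin> F" by (simp add: F0 axis_eq_0_iff)
      then obtain h where h: "h \<in> generated_monoid B" "2 * N 1 < N (h (axis i 1))"
        by (auto simp: F_def not_le)
      obtain m where m: "h \<in> family_power B m" using h(1) by (auto simp: generated_monoid_def)
      have hc: "h (axis i 1) \<in> cone_nonneg" by (rule monotone_sublinear_cone[OF Msl[OF h(1)] axis_in_cone])
      obtain j where j: "2 < h (axis i 1) $ j" using large_norm_coordinate[OF N hc h(2)] by blast
      \<comment> \<open>The identity keeps all coordinates of \<open>axis i 1\<close> at most 1, so the product is not empty.\<close>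
      have "axis i (1::real) $ j \<le> 1" by (simp add: axis_def)
      then have "m \<noteq> 0" using m j by (cases m) auto
      moreover have "2 *\<^sub>R axis j 1 \<le> h (axis i 1)" using hc j by (intro scaleR_axis_le) auto
      ultimately show ?thesis
        using m by (intro exI[of _ j] exI[of _ m] exI[of _ h] exI[of _ "2::real"]) auto
    qed
    obtain i m h c where h: "0 < m" "h \<in> family_power B m" "1 < c"
        "c *\<^sub>R axis i 1 \<le> h (axis i 1)"
      by (rule expansion_cycle[of B "\<lambda>c. 1 < c", OF Bsl _ less_1_mult]) (use out in auto)
    obtain g where g: "g \<in> family_power A m" "\<forall>x\<in>cone_nonneg. h x = s ^ m *\<^sub>R g x"
      using family_power_scaled[OF sl, where s = s and h = h and m = m] s h(2) unfolding Bdef by auto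
    have "(c / s ^ m) *\<^sub>R axis i 1 \<le> g (axis i 1)"
    proof -
      have "(1 / s ^ m) *\<^sub>R c *\<^sub>R axis i 1 \<le> (1 / s ^ m) *\<^sub>R s ^ m *\<^sub>R g (axis i 1)"
        using h(4) g(2) s by (intro scaleR_left_mono) auto
      then show ?thesis using s by simp
    qed
    then have "root m (c / s ^ m) \<le> joint_spectral_radius N A"
      using h(3) s by (intro joint_spectral_radius_ge_cycle[OF N sl bnd g(1) h(1)]) auto
    also have "\<dots> = 1 / s" by (simp add: s_def field_simps)
    finally have "root m c \<le> 1"
      using s h(1) by (simp add: real_root_divide real_root_power_cancel divide_right_mono field_simps)
    then show False using h(1,3) by simp
  qed
  ultimately show ?thesis
    using x unfolding B_def F_def by (auto simp: bdd_above_def)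
qed

text \<open>
  The common zeros of the maps form an invariant order ideal.  If it were \<open>{0}\<close>, every coordinate
  vector would have a nonzero image, and a cycle would make the joint spectral radius positive.
\<close>
lemma zero_radius_imp_zero_maps:
  fixes A :: "(real ^ 'n \<Rightarrow> real ^ 'n) set"
  assumes N: "monotone_norm N" and sl: "\<And>f. f \<in> A \<Longrightarrow> monotone_sublinear f"
    and bnd: "bounded_family N A" and irr: "irreducible_family A"
    and r: "joint_spectral_radius N A \<le> 0"
    and f: "f \<in> A" and x: "x \<in> cone_nonneg"
  shows "f x = 0"
proof -
  define Z where "Z = {x \<in> cone_nonneg. \<forall>f\<in>A. f x = 0}"
  have "Z = {0} \<or> Z = cone_nonneg"
  proof (rule irreducible_family_order_ideal[OF irr])
    show "Z \<subseteq> cone_nonneg" "0 \<in> Z" by (auto simp: Z_def monotone_sublinear_0[OF sl])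
    show "f x \<in> Z" if "f \<in> A" "x \<in> Z" for f x
      using that by (auto simp: Z_def monotone_sublinear_0[OF sl])
    show "c *\<^sub>R x \<in> Z" if "0 \<le> c" "x \<in> Z" for c x
      using that by (auto simp: Z_def monotone_sublinear_scaleR[OF sl] scaleR_in_cone)
    fix x y :: "real ^ 'n"
    show "y \<in> Z" if x: "x \<in> Z" and y: "y \<in> cone_nonneg" "y \<le> x"
    proof -
      have "f y = 0" if f: "f \<in> A" for f
      proof (rule cone_le_0_imp_eq_0[OF monotone_sublinear_cone[OF sl[OF f] y(1)]])
        show "f y \<le> 0"
          using monotone_sublinear_mono[OF sl[OF f] y(1) _ y(2)] x f by (auto simp: Z_def)
      qed
      then show ?thesis using y(1) by (simp add: Z_def)
    qed
    show "x + y \<in> Z" if "x \<in> Z" "y \<in> Z"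
    proof -
      have xy: "x \<in> cone_nonneg" "y \<in> cone_nonneg" and
        zero: "\<And>f. f \<in> A \<Longrightarrow> f x = 0 \<and> f y = 0"
        using that by (auto simp: Z_def)
      have "f (x + y) = 0" if f: "f \<in> A" for f
      proof (rule cone_le_0_imp_eq_0[OF monotone_sublinear_cone[OF sl[OF f] add_in_cone[OF xy]]])
        show "f (x + y) \<le> 0"
          using monotone_sublinear_add[OF sl[OF f] xy] zero[OF f] by simp
      qed
      then show ?thesis using xy by (simp add: Z_def add_in_cone)
    qed
  qed
  moreover have "Z \<noteq> {0}"
  proof
    assume Z0: "Z = {0}"
    have out: "\<exists>j m g c. 0 < m \<and> g \<in> family_power A m \<and> 0 < c \<and> c *\<^sub>R axis j 1 \<le> g (axis i 1)" for i
    proof -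
      have "axis i 1 \<notin> Z" by (simp add: Z0 axis_eq_0_iff)
      then obtain f where f: "f \<in> A" "f (axis i 1) \<noteq> 0" by (auto simp: Z_def)
      have fc: "f (axis i 1) \<in> cone_nonneg" by (rule monotone_sublinear_cone[OF sl[OF f(1)] axis_in_cone])
      obtain j where "f (axis i 1) $ j \<noteq> 0" using f(2) by (auto simp: vec_eq_iff)
      then have "0 < f (axis i 1) $ j" using fc by (auto simp: cone_nonneg_def less_eq_vec_def less_le)
      then show ?thesis
        using family_power_1[OF f(1)] scaleR_axis_le[OF fc order_refl, of j] zero_less_one by blast
    qed
    obtain i m g c where g: "0 < m" "g \<in> family_power A m" "0 < c"
        "c *\<^sub>R axis i 1 \<le> g (axis i 1)"
      by (rule expansion_cycle[of A "\<lambda>c. 0 < c", OF sl _ mult_pos_pos]) (use out in auto)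
    have "root m c \<le> joint_spectral_radius N A"
      using g(3,4) by (intro joint_spectral_radius_ge_cycle[OF N sl bnd g(2,1)]) auto
    then show False using r g(1,3) real_root_gt_zero[of m c] by linarith
  qed
  ultimately show ?thesis using f x by (auto simp: Z_def)
qed

section \<open>The orbit norm\<close>

lemma orbit_norm_upper:
  assumes "orbit_norm_finite N B" "h \<in> generated_monoid B"
  shows "N (h \<bar>x\<bar>) \<le> orbit_norm N B x"
  unfolding orbit_norm_def
  by (rule cSUP_upper[OF assms(2)]) (use assms(1) in \<open>simp add: orbit_norm_finite_def\<close>)

lemma orbit_norm_least:
  assumes "\<And>h. h \<in> generated_monoid B \<Longrightarrow> N (h \<bar>x\<bar>) \<le> K"
  shows "orbit_norm N B x \<le> K"
  unfolding orbit_norm_def using id_in_generated_monoid assms by (intro cSUP_least) auto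

lemma monotone_norm_orbit_norm:
  fixes B :: "(real ^ 'n \<Rightarrow> real ^ 'n) set"
  assumes N: "monotone_norm N" and sl: "\<And>f. f \<in> B \<Longrightarrow> monotone_sublinear f"
    and fin: "orbit_norm_finite N B"
  shows "monotone_norm (orbit_norm N B)"
proof -
  have Msl: "monotone_sublinear h" if "h \<in> generated_monoid B" for h
    using generated_monoid_monotone_sublinear sl that by blast
  have mono: "orbit_norm N B x \<le> orbit_norm N B y" if "\<bar>x\<bar> \<le> \<bar>y\<bar>" for x y
  proof (rule orbit_norm_least)
    fix h assume h: "h \<in> generated_monoid B"
    have "N (h \<bar>x\<bar>) \<le> N (h \<bar>y\<bar>)"
      using that by (intro monotone_norm_mono[OF N] monotone_sublinear_mono[OF Msl[OF h]]
          monotone_sublinear_cone[OF Msl[OF h]]) auto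
    then show "N (h \<bar>x\<bar>) \<le> orbit_norm N B y" using orbit_norm_upper[where N = N, OF fin h, of y] by simp
  qed
  have abs0: "\<bar>x\<bar> = 0 \<longleftrightarrow> x = 0" for x :: "real ^ 'n" by (simp add: abs_vec_def vec_eq_iff)
  have zero: "orbit_norm N B x = 0 \<longleftrightarrow> x = 0" for x
  proof
    assume "orbit_norm N B x = 0"
    then have "N \<bar>x\<bar> \<le> 0" using orbit_norm_upper[OF fin id_in_generated_monoid, of x] by simp
    then show "x = 0"
      using monotone_norm_nonneg[OF N, of "\<bar>x\<bar>"] monotone_norm_eq_0[OF N, of "\<bar>x\<bar>"] abs0 by simp
  next
    assume x: "x = 0"
    show "orbit_norm N B x = 0"
    proof (rule antisym)
      show "orbit_norm N B x \<le> 0"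
        unfolding x by (rule orbit_norm_least)
          (simp add: abs0 monotone_sublinear_0[OF Msl] monotone_norm_0[OF N])
      show "0 \<le> orbit_norm N B x"
        using orbit_norm_upper[OF fin id_in_generated_monoid, of x] monotone_norm_nonneg[OF N, of "\<bar>x\<bar>"]
        by simp
    qed
  qed
  have scale_le: "orbit_norm N B (c *\<^sub>R x) \<le> \<bar>c\<bar> * orbit_norm N B x" for c x
  proof (rule orbit_norm_least)
    fix h assume h: "h \<in> generated_monoid B"
    have "\<bar>c *\<^sub>R x\<bar> = \<bar>c\<bar> *\<^sub>R \<bar>x\<bar>" by (simp add: abs_vec_def vec_eq_iff abs_mult)
    then have "N (h \<bar>c *\<^sub>R x\<bar>) = \<bar>c\<bar> * N (h \<bar>x\<bar>)"
      by (simp add: monotone_sublinear_scaleR[OF Msl[OF h]] monotone_norm_scaleR[OF N])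
    also have "\<dots> \<le> \<bar>c\<bar> * orbit_norm N B x"
      using orbit_norm_upper[OF fin h] by (intro mult_left_mono) auto
    finally show "N (h \<bar>c *\<^sub>R x\<bar>) \<le> \<bar>c\<bar> * orbit_norm N B x" .
  qed
  have scale: "orbit_norm N B (c *\<^sub>R x) = \<bar>c\<bar> * orbit_norm N B x" for c x
  proof (cases "c = 0")
    case True
    then show ?thesis using zero[of 0] by simp
  next
    case False
    \<comment> \<open>The reverse inequality is \<open>scale_le\<close> for the factor \<open>inverse c\<close>.\<close>
    have "orbit_norm N B x \<le> \<bar>inverse c\<bar> * orbit_norm N B (c *\<^sub>R x)"
      using scale_le[of "inverse c" "c *\<^sub>R x"] False by simp
    then have "\<bar>c\<bar> * orbit_norm N B x \<le> orbit_norm N B (c *\<^sub>R x)"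
      using False by (simp add: field_simps)
    then show ?thesis using scale_le[of c x] by simp
  qed
  have add: "orbit_norm N B (x + y) \<le> orbit_norm N B x + orbit_norm N B y" for x y
  proof (rule orbit_norm_least)
    fix h assume h: "h \<in> generated_monoid B"
    note hc = monotone_sublinear_cone[OF Msl[OF h]]
    have tri: "\<bar>x + y\<bar> \<le> \<bar>x\<bar> + \<bar>y\<bar>" by (simp add: less_eq_vec_def abs_vec_def abs_triangle_ineq)
    have "N (h \<bar>x + y\<bar>) \<le> N (h (\<bar>x\<bar> + \<bar>y\<bar>))"
      by (intro monotone_norm_mono[OF N] monotone_sublinear_mono[OF Msl[OF h]] hc add_in_cone
          abs_in_cone tri)
    also have "\<dots> \<le> N (h \<bar>x\<bar> + h \<bar>y\<bar>)"
      by (intro monotone_norm_mono[OF N] monotone_sublinear_add[OF Msl[OF h]] hc add_in_cone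
          abs_in_cone)
    also have "\<dots> \<le> N (h \<bar>x\<bar>) + N (h \<bar>y\<bar>)" by (rule monotone_norm_triangle[OF N])
    also have "\<dots> \<le> orbit_norm N B x + orbit_norm N B y"
      by (intro add_mono orbit_norm_upper[OF fin h])
    finally show "N (h \<bar>x + y\<bar>) \<le> orbit_norm N B x + orbit_norm N B y" .
  qed
  have "orbit_norm N B x \<le> orbit_norm N B y" if "0 \<le> x" "x \<le> y" for x y
  proof (rule mono)
    have "x \<in> cone_nonneg" "y \<in> cone_nonneg" using that by (auto simp: cone_nonneg_def)
    then show "\<bar>x\<bar> \<le> \<bar>y\<bar>" using that(2) by (simp add: abs_of_cone)
  qed
  then show ?thesis
    unfolding monotone_norm_def is_norm_def using zero scale add by blast
qed

lemma orbit_norm_family_le: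
  assumes fin: "orbit_norm_finite N B" and f: "f \<in> B" "monotone_sublinear f"
    and x: "x \<in> cone_nonneg"
  shows "orbit_norm N B (f x) \<le> orbit_norm N B x"
proof (rule orbit_norm_least)
  fix h assume "h \<in> generated_monoid B"
  then have "N ((h \<circ> f) \<bar>x\<bar>) \<le> orbit_norm N B x"
    by (intro orbit_norm_upper[OF fin] comp_in_generated_monoid f(1))
  then show "N (h \<bar>f x\<bar>) \<le> orbit_norm N B x"
    using x monotone_sublinear_cone[OF f(2) x] by (simp add: abs_of_cone)
qed

text \<open>
  For radius \<open>0\<close> the rescaled maps vanish identically because \<open>inverse 0 = 0\<close>, so the orbit norm is
  automatically finite, and extremality rests on the maps of \<open>A\<close> themselves vanishing on the cone.
  That the radius is nonnegative is known only for a nonempty family.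
\<close>
lemma normalized_orbit_norm_extremal:
  fixes A :: "(real ^ 'n \<Rightarrow> real ^ 'n) set"
  assumes N: "monotone_norm N" and sl: "\<And>f. f \<in> A \<Longrightarrow> monotone_sublinear f"
    and bnd: "bounded_family N A" and irr: "irreducible_family A"
  shows "orbit_norm_finite N (normalized_family N A) \<and>
         monotone_norm (orbit_norm N (normalized_family N A)) \<and>
         extremal_norm N A (orbit_norm N (normalized_family N A))"
proof -
  let ?r = "joint_spectral_radius N A"
  let ?B = "normalized_family N A"
  have r0: "0 \<le> ?r" if "A \<noteq> {}"
    unfolding joint_spectral_radius_def
  proof (rule cINF_greatest)
    fix m :: nat
    have "family_power A m \<noteq> {}" by (rule family_power_nonempty[OF that])
    then obtain f where f: "f \<in> family_power A m" by blast
    have "0 \<le> root m (cone_opnorm N f)"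
      using cone_opnorm_nonneg[OF N family_power_monotone_sublinear[OF sl f]]
      by (cases "m = 0") auto
    also have "\<dots> \<le> (SUP f\<in>family_power A m. root m (cone_opnorm N f))"
      by (intro cSUP_upper f cone_opnorm_family_power_bdd[OF N sl bnd])
    finally show "0 \<le> (SUP f\<in>family_power A m. root m (cone_opnorm N f))" .
  qed simp
  have Bsl: "monotone_sublinear f" if f: "f \<in> ?B" for f
  proof -
    obtain e where e: "e \<in> A" "f = (\<lambda>x. inverse ?r *\<^sub>R e x)"
      using f by (auto simp: normalized_family_def)
    then have "A \<noteq> {}" by blast
    then show ?thesis
      unfolding e(2) using r0 by (intro monotone_sublinear_scale sl e(1)) simp
  qed
  have fin: "orbit_norm_finite N ?B"
  proof (cases "A = {}")
    case True
    then show ?thesis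
      by (simp add: normalized_family_def generated_monoid_empty orbit_norm_finite_def)
  next
    case False
    show ?thesis
    proof (cases "?r = 0")
      case True
      \<comment> \<open>All maps vanish on the cone, so that a product is the identity or zero there.\<close>
      have "h x \<in> cone_nonneg \<and> N (h x) \<le> 1 ^ m * N x"
        if "h \<in> family_power ?B m" "x \<in> cone_nonneg" for h m x
      proof (rule family_power_norm_le[OF _ _ that])
        show "\<forall>f\<in>?B. \<forall>x\<in>cone_nonneg. f x \<in> cone_nonneg \<and> N (f x) \<le> 1 * N x"
          using True monotone_norm_nonneg[OF N]
          by (auto simp: normalized_family_def monotone_norm_0[OF N])
      qed simp
      then have "N (h \<bar>x\<bar>) \<le> N \<bar>x\<bar>" if "h \<in> generated_monoid ?B" for h x
        using that abs_in_cone unfolding generated_monoid_def by fastforce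
      then show ?thesis
        unfolding orbit_norm_finite_def by (intro allI bdd_aboveI2)
    next
      case r: False
      then show ?thesis
        using r0[OF False] normalized_orbit_bounded[OF N sl bnd irr]
        by (auto simp: orbit_norm_finite_def)
    qed
  qed
  have mon: "monotone_norm (orbit_norm N ?B)"
    by (rule monotone_norm_orbit_norm[OF N Bsl fin])
  have "orbit_norm N ?B (f x) \<le> ?r * orbit_norm N ?B x" if f: "f \<in> A" and x: "x \<in> cone_nonneg" for f x
  proof (cases "?r = 0")
    case True
    then have "f x = 0" using zero_radius_imp_zero_maps[OF N sl bnd irr _ f x] by simp
    then show ?thesis using True monotone_norm_0[OF mon] by simp
  next
    case False
    then have r: "0 < ?r" using r0 f by fastforce
    have fB: "(\<lambda>x. inverse ?r *\<^sub>R f x) \<in> ?B" using f by (auto simp: normalized_family_def)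
    have "orbit_norm N ?B (inverse ?r *\<^sub>R f x) \<le> orbit_norm N ?B x"
      by (rule orbit_norm_family_le[OF fin fB Bsl[OF fB] x])
    then show ?thesis using r by (simp add: monotone_norm_scaleR[OF mon] field_simps)
  qed
  then have "extremal_norm N A (orbit_norm N ?B)"
    using mon by (simp add: extremal_norm_def monotone_norm_def)
  with fin mon show ?thesis by blast
qed

theorem theorem5p1:
  fixes A :: "(real ^ 'n \<Rightarrow> real ^ 'n) set"
    and N :: "real ^ 'n \<Rightarrow> real"
  assumes "\<And>f. f \<in> A \<Longrightarrow> maps_cone f \<and> subadditive_map f \<and> order_preserving f \<and> homogeneous f"
    and "monotone_norm N"
    and "bounded_family N A"
    and "irreducible_family A"
  shows "(orbit_norm_finite N (normalized_family N A) \<and>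
          monotone_norm (orbit_norm N (normalized_family N A)) \<and>
          extremal_norm N A (orbit_norm N (normalized_family N A))) \<and>
         (joint_spectral_radius N A = 1 \<longrightarrow>
          orbit_norm_finite N A \<and>
          monotone_norm (orbit_norm N A) \<and>
          extremal_norm N A (orbit_norm N A))"
proof -
  have sl: "\<And>f. f \<in> A \<Longrightarrow> monotone_sublinear f"
    using assms(1) by (simp add: monotone_sublinear_def)
  have "normalized_family N A = A" if "joint_spectral_radius N A = 1"
    using that by (simp add: normalized_family_def)
  then show ?thesis
    using normalized_orbit_norm_extremal[OF assms(2) sl assms(3,4)] by auto
qed

end
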